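(* Let $N=\{1,\dots,n\}$ be a finite set of agents, $A$ a non-empty finite set of objects, $a_0$ the outside option, and $\succ_A=(\succ_a)_{a\in A}$ a priority structure. On the domain $\mathbb{L}^n(A\cup\{a_0\})$ of all preference profiles, the FPTTC rule $T^{\succ_A}$ satisfies dual ownership if and only if it is strongly acyclic, i.e., if and only if the priority structure $\succ_A$ contains no weak cycle.
   Context: **Setting.** $N=\{1,\dots,n\}$ is a finite set of agents, $A$ a non-empty finite set of objects, and $a_0\notin A$ the outside option. An allocation is a function $\mu:N\to A\cup\{a_0\}$ with $|\mu^{-1}(a)|\le 1$ for all $a\in A$; $\mathcal{M}$ is the set of allocations. For a finite set $X$, $\mathbb{L}(X)$ is the set of strict linear orders on $X$; a preference is an element of $\mathbb{L}(A\cup\{a_0\})$, and $\mathbb{L}^n(A\cup\{a_0\})$ is the set of all preference profiles $P_N=(P_1,\dots,P_n)$. Object $a$ is acceptable to $i$ if $a\,P_i\,a_0$. A priority structure is a collection $\succ_A=(\succ_a)_{a\in A}$ with $\succ_a\in\mathbb{L}(N)$. For $\succ\,\in\mathbb{L}(N)$, $\tau(\succ,N')$ is the $\succ$-maximal agent in $N'\subseteq N$; $i\succ N'$ means $i\succ j$ for all $j\in N'$. **FPTTC rule.** The fixed priority top trading cycles (FPTTC) rule $T^{\succ_A}$ associated with $\succ_A$ is computed at a profile $P_N$ in steps. At Step $s$, let $N_s(P_N)$ and $A_s(P_N)$ be the sets of agents and objects remaining after Step $s-1$ (so $N_1(P_N)=N$, $A_1(P_N)=A$). Each $a\in A_s(P_N)$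 is owned by $\tau(\succ_a,N_s(P_N))$. Form the directed graph on $N_s(P_N)$ in which each agent $i$ points to the owner of her most preferred acceptable object in $A_s(P_N)$, or to herself if no object in $A_s(P_N)$ is acceptable to her. Each agent in a cycle of this graph (self-loops included) is assigned her most preferred element of $A_s(P_N)\cup\{a_0\}$; assigned agents and assigned objects are removed. The procedure is repeated until all agents or all objects are assigned; any agent unassigned at the end receives $a_0$. **Dual ownership.** On a domain $\mathcal{P}_N$, $T^{\succ_A}$ satisfies dual ownership if for all $P_N\in\mathcal{P}_N$ and every step $s$ of the procedure at $P_N$, the set of owners $\{\tau(\succ_a,N_s(P_N)) : a\in A_s(P_N)\}$ has at most two elements. **Strong acyclicity.** A tuple $[(i_1,i_2,i_3),(a_1,a_2,a_3)]$ with $i_1,i_2,i_3\in N$ distinct and $a_1,a_2,a_3\in A$ distinct is a weak cycle in $\succ_A$ if $i_1\succ_{a_1}\{i_2,i_3\}$, $i_2\succ_{a_2}\{i_1,i_3\}$, and $i_3\succ_{a_3}\{i_1,i_2\}$. A priority structure is strongly acyclic if it contains no weak cycle; $T^{\succ_A}$ is called strongly acyclic if $\succ_A$ is strongly acyclic. *)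

theory Defs
  imports Complex_Main "HOL-Library.FuncSet"
begin

text \<open>A strict linear order is a relation r in which (x, y) \<open>\<in>\<close> r means that x is ranked
  above y. Requiring r \<open>\<subseteq>\<close> X \<open>\<times>\<close> X makes it an order on X and on nothing else.\<close>

definition strict_lin_orders :: "'x set \<Rightarrow> 'x rel set" where
  "strict_lin_orders X = {r. r \<subseteq> X \<times> X \<and> strict_linear_order_on X r}"

definition ranks_above :: "'x rel \<Rightarrow> 'x \<Rightarrow> 'x set \<Rightarrow> bool" where
  "ranks_above r x Y \<longleftrightarrow> (\<forall>y\<in>Y. (x, y) \<in> r)"

text \<open>Used both for the highest-priority agent in a set and for the most preferred object in a
  set. Meaningful only if S is a non-empty finite subset of the ground set of r.\<close>

definition best :: "'x rel \<Rightarrow> 'x set \<Rightarrow> 'x" where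
  "best r S = (THE x. x \<in> S \<and> ranks_above r x (S - {x}))"

definition preference_profiles :: "'i set \<Rightarrow> 'a set \<Rightarrow> 'a \<Rightarrow> ('i \<Rightarrow> 'a rel) set" where
  "preference_profiles N A a0 = N \<rightarrow>\<^sub>E strict_lin_orders (A \<union> {a0})"

definition priority_structures :: "'i set \<Rightarrow> 'a set \<Rightarrow> ('a \<Rightarrow> 'i rel) set" where
  "priority_structures N A = A \<rightarrow> strict_lin_orders N"


text \<open>Below, M and B are the agents and the objects remaining at the start of a step.\<close>

definition owner :: "('a \<Rightarrow> 'i rel) \<Rightarrow> 'i set \<Rightarrow> 'a \<Rightarrow> 'i" where
  "owner pr M a = best (pr a) M"

definition acceptable :: "'a \<Rightarrow> 'a rel \<Rightarrow> 'a set \<Rightarrow> 'a set" where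
  "acceptable a0 r B = {a \<in> B. (a, a0) \<in> r}"

definition points_to ::
  "'a \<Rightarrow> ('a \<Rightarrow> 'i rel) \<Rightarrow> ('i \<Rightarrow> 'a rel) \<Rightarrow> 'i set \<Rightarrow> 'a set \<Rightarrow> 'i \<Rightarrow> 'i" where
  "points_to a0 pr P M B i =
     (if acceptable a0 (P i) B = {} then i
      else owner pr M (best (P i) (acceptable a0 (P i) B)))"

definition pointing_graph ::
  "'a \<Rightarrow> ('a \<Rightarrow> 'i rel) \<Rightarrow> ('i \<Rightarrow> 'a rel) \<Rightarrow> 'i set \<Rightarrow> 'a set \<Rightarrow> 'i rel" where
  "pointing_graph a0 pr P M B = {(i, points_to a0 pr P M B i) | i. i \<in> M}"

definition agents_in_cycles ::
  "'a \<Rightarrow> ('a \<Rightarrow> 'i rel) \<Rightarrow> ('i \<Rightarrow> 'a rel) \<Rightarrow> 'i set \<Rightarrow> 'a set \<Rightarrow> 'i set" where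
  "agents_in_cycles a0 pr P M B = {i \<in> M. (i, i) \<in> (pointing_graph a0 pr P M B)\<^sup>+}"

definition assigned_item :: "'a \<Rightarrow> ('i \<Rightarrow> 'a rel) \<Rightarrow> 'a set \<Rightarrow> 'i \<Rightarrow> 'a" where
  "assigned_item a0 P B i = best (P i) (B \<union> {a0})"

text \<open>The state is left unchanged once no agents or no objects remain: the procedure has
  stopped.\<close>

definition fpttc_step ::
  "'a \<Rightarrow> ('a \<Rightarrow> 'i rel) \<Rightarrow> ('i \<Rightarrow> 'a rel) \<Rightarrow> 'i set \<times> 'a set \<Rightarrow> 'i set \<times> 'a set" where
  "fpttc_step a0 pr P = (\<lambda>(M, B).
     if M = {} \<or> B = {} then (M, B)
     else (let C = agents_in_cycles a0 pr P M B
           in (M - C, B - assigned_item a0 P B ` C)))"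

text \<open>Index s counts completed steps, so these are the sets \<open>N\<^sub>s\<^sub>+\<^sub>1\<close> and \<open>A\<^sub>s\<^sub>+\<^sub>1\<close>
  of the usual numbering that starts with Step 1.\<close>

definition agents_after ::
  "'i set \<Rightarrow> 'a set \<Rightarrow> 'a \<Rightarrow> ('a \<Rightarrow> 'i rel) \<Rightarrow> ('i \<Rightarrow> 'a rel) \<Rightarrow> nat \<Rightarrow> 'i set" where
  "agents_after N A a0 pr P s = fst ((fpttc_step a0 pr P ^^ s) (N, A))"

definition objects_after ::
  "'i set \<Rightarrow> 'a set \<Rightarrow> 'a \<Rightarrow> ('a \<Rightarrow> 'i rel) \<Rightarrow> ('i \<Rightarrow> 'a rel) \<Rightarrow> nat \<Rightarrow> 'a set" where
  "objects_after N A a0 pr P s = snd ((fpttc_step a0 pr P ^^ s) (N, A))"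

text \<open>The outcome of the procedure: an agent gets what she is assigned in the step in which she
  is removed, and the outside option if she is never removed. Dual ownership, below, is a
  property of the steps of this procedure and not of its outcome alone.\<close>

definition fpttc_rule ::
  "'i set \<Rightarrow> 'a set \<Rightarrow> 'a \<Rightarrow> ('a \<Rightarrow> 'i rel) \<Rightarrow> ('i \<Rightarrow> 'a rel) \<Rightarrow> 'i \<Rightarrow> 'a" where
  "fpttc_rule N A a0 pr P i =
     (if \<exists>s. i \<in> agents_after N A a0 pr P s - agents_after N A a0 pr P (Suc s)
      then assigned_item a0 P
             (objects_after N A a0 pr P
               (THE s. i \<in> agents_after N A a0 pr P s - agents_after N A a0 pr P (Suc s))) i
      else a0)"

text \<open>A further step takes place exactly when both agents and objects remain.\<close>

definition dual_ownership ::
  "'i set \<Rightarrow> 'a set \<Rightarrow> 'a \<Rightarrow> ('a \<Rightarrow> 'i rel) \<Rightarrow> ('i \<Rightarrow> 'a rel) set \<Rightarrow> bool" where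
  "dual_ownership N A a0 pr D \<longleftrightarrow>
     (\<forall>P\<in>D. \<forall>s. agents_after N A a0 pr P s \<noteq> {} \<and> objects_after N A a0 pr P s \<noteq> {} \<longrightarrow>
        card (owner pr (agents_after N A a0 pr P s) ` objects_after N A a0 pr P s) \<le> 2)"

definition weak_cycle ::
  "'i set \<Rightarrow> 'a set \<Rightarrow> ('a \<Rightarrow> 'i rel) \<Rightarrow> 'i \<times> 'i \<times> 'i \<Rightarrow> 'a \<times> 'a \<times> 'a \<Rightarrow> bool" where
  "weak_cycle N A pr = (\<lambda>(i1, i2, i3) (a1, a2, a3).
     {i1, i2, i3} \<subseteq> N \<and> distinct [i1, i2, i3] \<and>
     {a1, a2, a3} \<subseteq> A \<and> distinct [a1, a2, a3] \<and>
     ranks_above (pr a1) i1 {i2, i3} \<and>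
     ranks_above (pr a2) i2 {i1, i3} \<and>
     ranks_above (pr a3) i3 {i1, i2})"

definition strongly_acyclic :: "'i set \<Rightarrow> 'a set \<Rightarrow> ('a \<Rightarrow> 'i rel) \<Rightarrow> bool" where
  "strongly_acyclic N A pr \<longleftrightarrow> (\<nexists>I X. weak_cycle N A pr I X)"

end

theory Submission
  imports Defs
begin

text \<open>Owners at a step are priority-maximal among the remaining agents, so three different
  owners at one step form a weak cycle. Conversely, let a weak cycle on agents
  \<open>I = {i1, i2, i3}\<close> be given. If \<open>I\<close> contains the owners of its three objects at Step 1, there
  are three owners at once. Otherwise some agent \<open>j \<notin> I\<close> owns an object \<open>b\<close> at Step 1. Let the
  agents in \<open>I\<close> rank \<open>b\<close> first and let all others find nothing acceptable: Step 1 removes exactly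
  the agents outside \<open>I\<close> and no object, so Step 2 has three owners.\<close>

section \<open>Strict linear orders and their best elements\<close>

lemma strict_lin_orders_asym:
  assumes "r \<in> strict_lin_orders X" and "(x, y) \<in> r"
  shows "(y, x) \<notin> r"
  using assms unfolding strict_lin_orders_def strict_linear_order_on_def
  by (auto dest: transD simp: irrefl_def)

lemma best_eqI:
  assumes "r \<in> strict_lin_orders X" and "x \<in> S" and "ranks_above r x (S - {x})"
  shows "best r S = x"
  unfolding best_def
proof (rule the_equality)
  fix y assume y: "y \<in> S \<and> ranks_above r y (S - {y})"
  show "y = x"
  proof (rule ccontr)
    assume "y \<noteq> x"
    with y assms have "(x, y) \<in> r" "(y, x) \<in> r"
      by (auto simp: ranks_above_def)
    with strict_lin_orders_asym[OF assms(1)] show False by blast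
  qed
qed (use assms in simp)

lemma ex_best:
  assumes r: "r \<in> strict_lin_orders X"
    and "finite S" "S \<noteq> {}" "S \<subseteq> X"
  shows "\<exists>x\<in>S. ranks_above r x (S - {x})"
  using assms(2-)
proof (induction S rule: finite_ne_induct)
  case (singleton x)
  then show ?case by (simp add: ranks_above_def)
next
  case (insert y S)
  then obtain x where x: "x \<in> S" "ranks_above r x (S - {x})" by auto
  have tr: "trans r" and tot: "total_on X r"
    using r by (auto simp: strict_lin_orders_def strict_linear_order_on_def)
  have "(x, y) \<in> r \<or> (y, x) \<in> r"
    using tot insert.prems insert.hyps x(1) by (metis insert_subset subsetD total_on_def)
  then show ?case
  proof
    assume "(x, y) \<in> r"
    with x show ?thesis by (intro bexI[of _ x]) (auto simp: ranks_above_def)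
  next
    assume "(y, x) \<in> r"
    then have "(y, z) \<in> r" if "z \<in> S" for z
      using x that tr by (cases "z = x") (auto simp: ranks_above_def dest: transD)
    then show ?thesis by (intro bexI[of _ y]) (auto simp: ranks_above_def)
  qed
qed

lemma best_in_and_above:
  assumes "r \<in> strict_lin_orders X" and "finite S" "S \<noteq> {}" "S \<subseteq> X"
  shows "best r S \<in> S" and "ranks_above r (best r S) (S - {best r S})"
proof -
  obtain x where "x \<in> S" "ranks_above r x (S - {x})"
    using ex_best[OF assms] by blast
  with best_eqI[OF assms(1)]
  show "best r S \<in> S" and "ranks_above r (best r S) (S - {best r S})" by simp_all
qed

text \<open>Supplies the preferences of the constructed profiles, where only the top element
  matters: an injection into the naturals orders the rest arbitrarily.\<close>

lemma ex_strict_lin_order_top: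
  assumes "finite X" and "x \<in> X"
  shows "\<exists>r\<in>strict_lin_orders X. ranks_above r x (X - {x})"
proof -
  obtain f :: "'a \<Rightarrow> nat" where f: "inj_on f X"
    using finite_imp_inj_to_nat_seg[OF assms(1)] by blast
  \<comment> \<open>The shift by \<open>Suc\<close> reserves the value 0 for \<open>x\<close>, so
    \<open>g\<close> stays injective; smaller values rank higher.\<close>
  define g where "g y = (if y = x then 0 else Suc (f y))" for y
  define r where "r = {(y, z). y \<in> X \<and> z \<in> X \<and> g y < g z}"
  have "inj_on g X"
    using f by (auto simp: inj_on_def g_def)
  then have "total_on X r"
    unfolding total_on_def r_def by (auto simp: inj_on_def) (meson linorder_neqE_nat)
  moreover have "trans r" "irrefl r" "r \<subseteq> X \<times> X"
    by (auto simp: r_def trans_def irrefl_def)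
  ultimately have r: "r \<in> strict_lin_orders X"
    by (simp add: strict_lin_orders_def strict_linear_order_on_def)
  with assms(2) show ?thesis
    by (intro bexI[of _ r]) (auto simp: ranks_above_def r_def g_def)
qed

section \<open>Owners, and why strong acyclicity bounds their number\<close>

lemma owner_in_and_above:
  assumes "pr \<in> priority_structures N A" and "finite N" and "M \<subseteq> N" "M \<noteq> {}" and "a \<in> A"
  shows "owner pr M a \<in> M" and "ranks_above (pr a) (owner pr M a) (M - {owner pr M a})"
proof -
  have "pr a \<in> strict_lin_orders N"
    using assms by (auto simp: priority_structures_def)
  moreover have "finite M"
    using assms finite_subset by blast
  ultimately show "owner pr M a \<in> M"
    and "ranks_above (pr a) (owner pr M a) (M - {owner pr M a})"
    using best_in_and_above[of "pr a" N M] assms by (simp_all add: owner_def)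
qed

lemma owner_weak_cycle:
  assumes pr: "pr \<in> priority_structures N A"
    and "weak_cycle N A pr (i1, i2, i3) (a1, a2, a3)"
  shows "owner pr {i1, i2, i3} ` {a1, a2, a3} = {i1, i2, i3}"
proof -
  have wc: "ranks_above (pr a1) i1 {i2, i3}" "ranks_above (pr a2) i2 {i1, i3}"
    "ranks_above (pr a3) i3 {i1, i2}" "{a1, a2, a3} \<subseteq> A"
    using assms(2) by (auto simp: weak_cycle_def)
  then have "pr a1 \<in> strict_lin_orders N" "pr a2 \<in> strict_lin_orders N"
    "pr a3 \<in> strict_lin_orders N"
    using pr by (auto simp: priority_structures_def)
  with wc have "owner pr {i1, i2, i3} a1 = i1" "owner pr {i1, i2, i3} a2 = i2"
    "owner pr {i1, i2, i3} a3 = i3"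
    unfolding owner_def by (auto intro!: best_eqI simp: ranks_above_def)
  then show ?thesis by simp
qed

text \<open>Top priority in a set is inherited by every subset that still contains the top agent, so
  removing other agents cannot change an owner.\<close>

lemma owner_subset:
  assumes pr: "pr \<in> priority_structures N A" and "finite N" and "M \<subseteq> N" and "a \<in> A"
    and "L \<subseteq> M" and "owner pr M a \<in> L"
  shows "owner pr L a = owner pr M a"
proof -
  have "ranks_above (pr a) (owner pr M a) (M - {owner pr M a})"
    using owner_in_and_above(2)[OF pr] assms by blast
  then have "ranks_above (pr a) (owner pr M a) (L - {owner pr M a})"
    using \<open>L \<subseteq> M\<close> by (auto simp: ranks_above_def)
  with assms have "best (pr a) L = owner pr M a"
    by (intro best_eqI[of _ N]) (auto simp: priority_structures_def)
  then show ?thesis by (simp add: owner_def)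
qed

lemma agents_after_subset: "agents_after N A a0 pr P s \<subseteq> N"
  and objects_after_subset: "objects_after N A a0 pr P s \<subseteq> A"
  unfolding agents_after_def objects_after_def
  by (induction s) (auto simp: fpttc_step_def case_prod_beta Let_def split: if_splits)

text \<open>Arbitrary \<open>M\<close> and \<open>B\<close> replace the sets of a step: the argument
  uses nothing about how the procedure reached them.\<close>

lemma strongly_acyclic_imp_card_owners_le_2:
  assumes pr: "pr \<in> priority_structures N A" and "finite N"
    and M: "M \<subseteq> N" "M \<noteq> {}" and B: "B \<subseteq> A"
    and sa: "strongly_acyclic N A pr"
  shows "card (owner pr M ` B) \<le> 2"
proof (rule ccontr)
  assume "\<not> card (owner pr M ` B) \<le> 2"
  then have "3 \<le> card (owner pr M ` B)" by simp
  then obtain T where T: "T \<subseteq> owner pr M ` B" "card T = 3"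
    by (meson obtain_subset_with_card_n)
  then obtain i1 i2 i3 where i: "T = {i1, i2, i3}" "i1 \<noteq> i2" "i2 \<noteq> i3" "i1 \<noteq> i3"
    by (auto simp: card_3_iff)
  then obtain a1 a2 a3 where a: "a1 \<in> B" "a2 \<in> B" "a3 \<in> B"
    and o: "owner pr M a1 = i1" "owner pr M a2 = i2" "owner pr M a3 = i3"
    using T by auto
  have "owner pr M a \<in> M \<and> ranks_above (pr a) (owner pr M a) (M - {owner pr M a})"
    if "a \<in> B" for a
    using owner_in_and_above[OF pr \<open>finite N\<close> M, of a] B that by blast
  \<comment> \<open>The three objects are distinct because their owners are.\<close>
  from this[OF a(1)] this[OF a(2)] this[OF a(3)]
  have "weak_cycle N A pr (i1, i2, i3) (a1, a2, a3)"
    using i a o M B by (auto simp: weak_cycle_def ranks_above_def)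
  with sa show False by (auto simp: strongly_acyclic_def)
qed

section \<open>Cycles of the pointing graph, and the profile built from a weak cycle\<close>

lemma self_loop_in_cycles:
  assumes "i \<in> M" and "points_to a0 pr P M B i = i"
  shows "i \<in> agents_in_cycles a0 pr P M B"
proof -
  have "(i, i) \<in> pointing_graph a0 pr P M B"
    using assms by (auto simp: pointing_graph_def intro!: exI[of _ i])
  with assms(1) show ?thesis by (auto simp: agents_in_cycles_def)
qed

text \<open>Each agent has only one outgoing edge, so a self-loop is absorbing: a walk from
  \<open>i\<close> enters \<open>j\<close> at once and never returns.\<close>

lemma points_to_self_loop_not_in_cycles:
  assumes "points_to a0 pr P M B i = j" and "points_to a0 pr P M B j = j" and "i \<noteq> j"
  shows "i \<notin> agents_in_cycles a0 pr P M B"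
proof
  assume "i \<in> agents_in_cycles a0 pr P M B"
  then have "(i, i) \<in> (pointing_graph a0 pr P M B)\<^sup>+"
    by (simp add: agents_in_cycles_def)
  moreover have "y = j" if "(i, y) \<in> (pointing_graph a0 pr P M B)\<^sup>+" for y
    using that by (induction rule: trancl_induct) (use assms in \<open>auto simp: pointing_graph_def\<close>)
  ultimately show False using assms(3) by blast
qed

lemma ex_profile_removing_outsiders:
  assumes pr: "pr \<in> priority_structures N A" and "finite A" and "a0 \<notin> A"
    and I: "I \<subseteq> N" and j: "j \<in> N - I" and b: "b \<in> A" "owner pr N b = j"
  shows "\<exists>P\<in>preference_profiles N A a0.
    agents_after N A a0 pr P 1 = I \<and> objects_after N A a0 pr P 1 = A"
proof -
  \<comment> \<open>Under \<open>q\<close> the outside option beats every object; under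
    \<open>r\<close> the object \<open>b\<close> beats everything, including \<open>a0\<close>, and
    so is acceptable.\<close>
  obtain q where q: "q \<in> strict_lin_orders (A \<union> {a0})" "ranks_above q a0 (A \<union> {a0} - {a0})"
    using ex_strict_lin_order_top[of "A \<union> {a0}" a0] \<open>finite A\<close>
    by (metis UnI2 finite.emptyI finite_Un finite_insert singletonI)
  obtain r where r: "r \<in> strict_lin_orders (A \<union> {a0})" "ranks_above r b (A \<union> {a0} - {b})"
    using ex_strict_lin_order_top[of "A \<union> {a0}" b] \<open>finite A\<close> b
    by (metis UnI1 finite.emptyI finite_Un finite_insert)
  define P where "P = (\<lambda>i\<in>N. if i \<in> I then r else q)"
  have "P \<in> preference_profiles N A a0"
    using q r by (auto simp: preference_profiles_def P_def)
  have "(a, a0) \<notin> q" if "a \<in> A" for a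
    using strict_lin_orders_asym[OF q(1), of a0 a] q(2) that \<open>a0 \<notin> A\<close>
    by (auto simp: ranks_above_def)
  then have self: "points_to a0 pr P N A i = i" if "i \<in> N - I" for i
    using that by (auto simp: points_to_def P_def acceptable_def)
  have "b \<in> acceptable a0 r A"
    using r b \<open>a0 \<notin> A\<close> by (auto simp: acceptable_def ranks_above_def)
  moreover from this have "best r (acceptable a0 r A) = b"
    using r by (intro best_eqI[OF r(1)]) (auto simp: acceptable_def ranks_above_def)
  ultimately have "points_to a0 pr P N A i = j" if "i \<in> I" for i
    using that b I by (auto simp: points_to_def P_def)
  \<comment> \<open>Agents in \<open>I\<close> all point to \<open>j\<close>, who lies outside
    \<open>I\<close> and therefore points to herself.\<close>
  then have "i \<notin> agents_in_cycles a0 pr P N A" if "i \<in> I" for i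
    using that j self by (intro points_to_self_loop_not_in_cycles[where j = j]) auto
  moreover have "agents_in_cycles a0 pr P N A \<subseteq> N"
    by (auto simp: agents_in_cycles_def)
  ultimately have C: "agents_in_cycles a0 pr P N A = N - I"
    using self_loop_in_cycles[OF _ self] by blast
  \<comment> \<open>The outsiders leave with \<open>a0\<close>, which is not in \<open>A\<close>, so
    their departure removes no object.\<close>
  have "best q (A \<union> {a0}) = a0"
    using q by (intro best_eqI) auto
  then have "assigned_item a0 P A i = a0" if "i \<in> N - I" for i
    using that by (auto simp: assigned_item_def P_def)
  then have "A - assigned_item a0 P A ` (N - I) = A"
    using \<open>a0 \<notin> A\<close> by auto
  moreover have "N - (N - I) = I" "N \<noteq> {}" "A \<noteq> {}"
    using I j b by auto
  ultimately have "fpttc_step a0 pr P (N, A) = (I, A)"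
    by (simp add: fpttc_step_def C)
  with \<open>P \<in> preference_profiles N A a0\<close> show ?thesis
    by (intro bexI[of _ P]) (simp_all add: agents_after_def objects_after_def)
qed

lemma weak_cycle_imp_not_dual_ownership:
  assumes pr: "pr \<in> priority_structures N A" and "finite N" and "finite A" and "a0 \<notin> A"
    and wc: "weak_cycle N A pr (i1, i2, i3) (a1, a2, a3)"
  shows "\<not> dual_ownership N A a0 pr (preference_profiles N A a0)"
proof -
  define I where "I = {i1, i2, i3}"
  define X where "X = {a1, a2, a3}"
  have I: "I \<subseteq> N" "card I = 3" "I \<noteq> {}" and X: "X \<subseteq> A" "X \<noteq> {}"
    using wc by (auto simp: weak_cycle_def I_def X_def)
  have oI: "owner pr I ` X = I"
    using owner_weak_cycle[OF pr wc] by (simp add: I_def X_def)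
  \<comment> \<open>The index \<open>s\<close> counts completed steps: the witness is 0 if all
    owners of \<open>X\<close> lie in \<open>I\<close>, and 1 if outsiders must leave first.\<close>
  have "\<exists>P\<in>preference_profiles N A a0. \<exists>s. agents_after N A a0 pr P s \<noteq> {} \<and>
    objects_after N A a0 pr P s = A \<and> I \<subseteq> owner pr (agents_after N A a0 pr P s) ` A"
  proof (cases "owner pr N ` X \<subseteq> I")
    case True
    \<comment> \<open>These owners survive the restriction from \<open>N\<close> to
      \<open>I\<close>, so they are the owners within \<open>I\<close>, which are all of
      \<open>I\<close> by the weak cycle.\<close>
    then have "owner pr I a = owner pr N a" if "a \<in> X" for a
      using that X I by (intro owner_subset[OF pr \<open>finite N\<close>]) auto
    then have "owner pr N ` X = owner pr I ` X"
      by (simp cong: image_cong_simp)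
    with oI have "I \<subseteq> owner pr N ` A"
      using X(1) by blast
    moreover obtain r where "r \<in> strict_lin_orders (A \<union> {a0})"
      using ex_strict_lin_order_top[of "A \<union> {a0}" a0] \<open>finite A\<close> by auto
    then have "(\<lambda>i\<in>N. r) \<in> preference_profiles N A a0"
      by (auto simp: preference_profiles_def)
    ultimately show ?thesis
      using I by (intro bexI[of _ "\<lambda>i\<in>N. r"] exI[of _ 0])
        (auto simp: agents_after_def objects_after_def)
  next
    case False
    then obtain b where b: "b \<in> X" "owner pr N b \<notin> I" by auto
    moreover have "owner pr N b \<in> N"
      using owner_in_and_above(1)[OF pr \<open>finite N\<close>] b X I by blast
    ultimately obtain P where "P \<in> preference_profiles N A a0"
      "agents_after N A a0 pr P 1 = I" "objects_after N A a0 pr P 1 = A"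
      using ex_profile_removing_outsiders[OF pr \<open>finite A\<close> \<open>a0 \<notin> A\<close> I(1), of "owner pr N b" b] X
      by auto
    moreover have "I \<subseteq> owner pr I ` A"
      using oI X by blast
    ultimately show ?thesis
      using I by (intro bexI[of _ P] exI[of _ 1]) auto
  qed
  then obtain P s where P: "P \<in> preference_profiles N A a0" "agents_after N A a0 pr P s \<noteq> {}"
    "objects_after N A a0 pr P s = A" "I \<subseteq> owner pr (agents_after N A a0 pr P s) ` A"
    by blast
  then have "3 \<le> card (owner pr (agents_after N A a0 pr P s) ` objects_after N A a0 pr P s)"
    using card_mono[of "owner pr (agents_after N A a0 pr P s) ` A" I] \<open>finite A\<close> I by simp
  moreover have "A \<noteq> {}" using X by auto
  ultimately show ?thesis
    using P unfolding dual_ownership_def by fastforce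
qed

theorem theorem4p3:
  fixes n :: nat and A :: "'a set" and a0 :: 'a and pr :: "'a \<Rightarrow> nat rel"
  assumes "finite A" and "A \<noteq> {}" and "a0 \<notin> A"
    and "pr \<in> priority_structures {1..n} A"
  shows "dual_ownership {1..n} A a0 pr (preference_profiles {1..n} A a0)
    \<longleftrightarrow> strongly_acyclic {1..n} A pr"
proof
  assume "dual_ownership {1..n} A a0 pr (preference_profiles {1..n} A a0)"
  then have "\<not> weak_cycle {1..n} A pr (i1, i2, i3) (a1, a2, a3)" for i1 i2 i3 a1 a2 a3
    using weak_cycle_imp_not_dual_ownership[OF assms(4) _ assms(1,3)] by blast
  then show "strongly_acyclic {1..n} A pr"
    unfolding strongly_acyclic_def by (metis prod_cases3)
next
  assume "strongly_acyclic {1..n} A pr"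
  then show "dual_ownership {1..n} A a0 pr (preference_profiles {1..n} A a0)"
    unfolding dual_ownership_def
    using strongly_acyclic_imp_card_owners_le_2[OF assms(4)]
    by (simp add: agents_after_subset objects_after_subset)
qed

end
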